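(* Let $n\ge 1$, and let $m=(m_1,\dots,m_n)$ and $m'=(m'_1,\dots,m'_n)$ be integer $n$-tuples with $m_1>m_2>\cdots>m_n>0$ and $m'_1>m'_2>\cdots>m'_n>0$. Then $$2^{2n}\int_{\overline F}\sin^-_m(x)\,\sin^-_{m'}(x)\,dx=\delta_{m,m'} .$$
   Context: $\sin^-_m(x):=\det\big(\sin 2\pi m_ix_j\big)_{i,j=1}^n$ for $x=(x_1,\dots,x_n)\in\mathbb R^n$. $\overline F=\{x\in\mathbb R^n:\ \tfrac12\ge x_1\ge x_2\ge\cdots\ge x_n\ge 0\}$, and $dx$ is Lebesgue (Euclidean) measure. *)

theory Defs
  imports "HOL-Analysis.Analysis"
begin

text \<open>
  Coordinates are indexed by a finite linearly ordered type \<open>'n\<close> (order-isomorphic to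
  \<open>{1, \<dots>, n}\<close> with \<open>n = CARD('n) \<ge> 1\<close>), so that the index order needed below is available
  on \<open>real ^ 'n\<close>.
\<close>

definition sin_minus :: "int ^ 'n \<Rightarrow> real ^ 'n \<Rightarrow> real" where
  "sin_minus m x = det (\<chi> i j. sin (2 * pi * real_of_int (m $ i) * x $ j))"

definition closed_F :: "(real ^ 'n::{finite,linorder}) set" where
  "closed_F = {x. (\<forall>i. 0 \<le> x $ i \<and> x $ i \<le> 1/2) \<and> (\<forall>i j. i \<le> j \<longrightarrow> x $ j \<le> x $ i)}"

definition strictly_decreasing_positive :: "int ^ 'n::{finite,linorder} \<Rightarrow> bool" where
  "strictly_decreasing_positive m \<longleftrightarrow> (\<forall>i j. i < j \<longrightarrow> m $ j < m $ i) \<and> (\<forall>i. 0 < m $ i)"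

end

theory Submission
  imports Defs
begin

text \<open>
  The integrand is invariant under permutations of the coordinates, and the images of the simplex
  under these permutations tile the cube of side \<open>1/2\<close> up to a null set, so the integral over the
  cube is \<open>n!\<close> times the integral over the simplex. On the cube, expanding both determinants and
  applying Fubini leaves products of one-dimensional integrals of \<open>sin (2 \<pi> a t) sin (2 \<pi> b t)\<close>,
  which are \<open>1/4\<close> or \<open>0\<close>; only the \<open>n!\<close> pairs of equal permutations survive.
\<close>

subsection \<open>Sorting permutations\<close>

text \<open>The rank of \<open>i\<close> grows strictly with \<open>f i\<close>, so distinct values
  get distinct ranks. No index counts itself, so ranks stay below \<open>CARD('n)\<close>, and
  cardinality makes the map onto.\<close>

lemma bij_betw_card_less:
  fixes f :: "'n::finite \<Rightarrow> 'a::linorder"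
  assumes "inj f"
  shows "bij_betw (\<lambda>i. card {j. f j < f i}) UNIV {..<CARD('n)}"
proof -
  let ?r = "\<lambda>i. card {j. f j < f i}"
  have mono: "?r i < ?r k" if "f i < f k" for i k
    by (rule psubset_card_mono) (use that in auto)
  have "inj ?r"
    by (metis (mono_tags, lifting) assms inj_def less_irrefl linorder_neqE mono)
  moreover have "range ?r \<subseteq> {..<CARD('n)}"
    by (auto intro!: psubset_card_mono)
  ultimately show ?thesis
    unfolding bij_betw_def
    by (metis card_image card_lessThan card_subset_eq finite_lessThan)
qed

text \<open>Since \<open>p\<close> reverses the order, the values above \<open>f (p i)\<close> sit
  exactly at the \<open>p\<close>-images of the indices before \<open>i\<close>. The rank counted
  from the top is therefore the same for every sorting \<open>p\<close>.\<close>

lemma card_less_comp_strict_antimono: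
  fixes f :: "'n::{finite,linorder} \<Rightarrow> 'a::linorder" and p :: "'n \<Rightarrow> 'n"
  assumes "bij p" and "\<And>i j. i < j \<Longrightarrow> f (p j) < f (p i)"
  shows "card {j. f (p i) < f j} = card {j. j < i}"
proof -
  have "f (p i) < f (p j) \<longleftrightarrow> j < i" for j
    using assms(2)[of i j] assms(2)[of j i] by (cases rule: linorder_cases[of i j]) auto
  then have "{j. f (p i) < f j} = p ` {j. j < i}"
    using \<open>bij p\<close> by (auto simp: image_iff) (metis bij_pointE)
  with \<open>bij p\<close> show ?thesis
    by (metis bij_is_inj card_image inj_on_subset subset_UNIV)
qed

text \<open>\<open>f (p i)\<close> and \<open>f (q i)\<close> have equally many values above them.
  The larger of two different values has strictly fewer, so the two agree, and \<open>f\<close> is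
  injective.\<close>

lemma sorting_permutation_unique:
  fixes f :: "'n::{finite,linorder} \<Rightarrow> 'a::linorder" and p q :: "'n \<Rightarrow> 'n"
  assumes "inj f" "bij p" "bij q"
    and "\<And>i j. i < j \<Longrightarrow> f (p j) < f (p i)" and "\<And>i j. i < j \<Longrightarrow> f (q j) < f (q i)"
  shows "p = q"
proof
  fix i
  have *: "card {j. f (p i) < f j} = card {j. f (q i) < f j}"
    using card_less_comp_strict_antimono[of p f i] card_less_comp_strict_antimono[of q f i] assms
    by metis
  have "\<not> f (p i) < f (q i)"
  proof
    assume "f (p i) < f (q i)"
    then have "card {j. f (q i) < f j} < card {j. f (p i) < f j}"
      by (intro psubset_card_mono) auto
    with * show False by simp
  qed
  moreover have "\<not> f (q i) < f (p i)"
  proof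
    assume "f (q i) < f (p i)"
    then have "card {j. f (p i) < f j} < card {j. f (q i) < f j}"
      by (intro psubset_card_mono) auto
    with * show False by simp
  qed
  ultimately show "p i = q i"
    using \<open>inj f\<close> by (meson injD linorder_neqE)
qed

lemma sorting_permutation_exists:
  fixes f :: "'n::{finite,linorder} \<Rightarrow> 'a::linordered_ab_group_add"
  assumes "inj f"
  obtains p where "p permutes UNIV" "\<And>i j. i < j \<Longrightarrow> f (p j) < f (p i)"
proof -
  \<comment> \<open>Negation makes \<open>?r\<close> count the larger values, so rank 0 belongs to
    the maximum.\<close>
  let ?r = "\<lambda>i. card {j. - f j < - f i}" and ?s = "\<lambda>i::'n. card {j. j < i}"
  have r: "bij_betw ?r UNIV {..<CARD('n)}"
    by (rule bij_betw_card_less) (use assms in \<open>simp add: inj_def\<close>)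
  have s: "bij_betw ?s UNIV {..<CARD('n)}"
    using bij_betw_card_less[of "\<lambda>i::'n. i"] by (simp add: inj_def)
  \<comment> \<open>\<open>p i\<close> is the index whose descending rank equals the position of
    \<open>i\<close> in the index order.\<close>
  define p where "p = inv_into UNIV ?r \<circ> ?s"
  have "bij p"
    unfolding p_def using s bij_betw_inv_into[OF r] by (rule bij_betw_trans)
  have rp: "?r (p i) = ?s i" for i
    unfolding p_def o_def
    by (rule bij_betw_inv_into_right[OF r]) (use s in \<open>auto simp: bij_betw_def\<close>)
  have "f (p j) < f (p i)" if "i < j" for i j
  proof (rule ccontr)
    assume "\<not> f (p j) < f (p i)"
    then have "?r (p j) \<le> ?r (p i)"
      by (intro card_mono) auto
    moreover have "?s i < ?s j"
      by (rule psubset_card_mono) (use that in auto)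
    ultimately show False
      using rp by (metis linorder_not_le)
  qed
  moreover have "p permutes UNIV"
    using \<open>bij p\<close> by (intro bij_imp_permutes) auto
  ultimately show thesis using that by blast
qed

subsection \<open>Lebesgue measure in coordinates\<close>

lemma prod_Basis_vec: "(\<Prod>b\<in>(Basis :: (real ^ 'n) set). f b) = (\<Prod>i\<in>UNIV. f (axis i 1))"
proof -
  have "(Basis :: (real ^ 'n) set) = range (\<lambda>i. axis i 1)"
    by (auto simp: Basis_vec_def)
  moreover have "prod f (range (\<lambda>i::'n. axis i 1)) = (\<Prod>i\<in>UNIV. f (axis i 1))"
    by (subst prod.reindex) (auto simp: inj_def axis_eq_axis)
  ultimately show ?thesis by simp
qed

lemma lborel_vec_eqI:
  fixes M :: "(real ^ 'n) measure"
  assumes "\<And>l u. (\<And>i. l $ i \<le> u $ i) \<Longrightarrow> emeasure M (box l u) = ennreal (\<Prod>i\<in>UNIV. u $ i - l $ i)"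
    and "sets M = sets borel"
  shows "lborel = M"
proof (rule lborel_eqI)
  fix l u :: "real ^ 'n"
  assume *: "\<And>b. b \<in> Basis \<Longrightarrow> l \<bullet> b \<le> u \<bullet> b"
  have "l $ i \<le> u $ i" for i
    using *[of "axis i 1"] by (simp add: axis_in_Basis_iff inner_axis)
  then show "emeasure M (box l u) = (\<Prod>b\<in>Basis. (u - l) \<bullet> b)"
    by (simp add: assms(1) prod_Basis_vec inner_axis)
qed (fact assms(2))

lemma emeasure_lborel_box_cart:
  fixes l u :: "real ^ 'n"
  assumes "\<And>i. l $ i \<le> u $ i"
  shows "emeasure lborel (box l u) = ennreal (\<Prod>i\<in>UNIV. u $ i - l $ i)"
proof -
  have "l \<bullet> b \<le> u \<bullet> b" if "b \<in> Basis" for b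
    using that assms by (auto simp: Basis_vec_def inner_axis)
  then show ?thesis
    by (simp add: emeasure_lborel_box prod_Basis_vec inner_axis)
qed

lemma borel_measurable_vec_lambda:
  fixes f :: "'a \<Rightarrow> 'n::finite \<Rightarrow> real"
  assumes "\<And>i. (\<lambda>x. f x i) \<in> borel_measurable M"
  shows "(\<lambda>x. \<chi> i. f x i) \<in> borel_measurable M"
  by (subst borel_measurable_euclidean_space)
    (use assms in \<open>auto simp: Basis_vec_def inner_axis\<close>)

text \<open>Both measures give a box the product of its side lengths, which determines a Borel
  measure. This opens the way to Fubini on \<open>real ^ 'n\<close>.\<close>

lemma lborel_vec_eq_distr_PiM:
  "(lborel :: (real ^ 'n) measure) = distr (\<Pi>\<^sub>M i\<in>UNIV. lborel) borel vec_lambda"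
proof (rule lborel_vec_eqI)
  interpret product_sigma_finite "\<lambda>i::'n. lborel :: real measure"
    by standard
  have [measurable]: "(vec_lambda :: _ \<Rightarrow> real ^ 'n) \<in> borel_measurable (\<Pi>\<^sub>M i\<in>UNIV. lborel)"
    by (rule borel_measurable_vec_lambda) measurable
  fix l u :: "real ^ 'n"
  assume le: "\<And>i. l $ i \<le> u $ i"
  have "vec_lambda -` box l u = (\<Pi>\<^sub>E i\<in>UNIV. {l $ i<..<u $ i})"
    by (auto simp: mem_box_cart PiE_iff)
  then show "emeasure (distr (\<Pi>\<^sub>M i\<in>UNIV. lborel) borel vec_lambda) (box l u)
      = ennreal (\<Prod>i\<in>UNIV. u $ i - l $ i)"
    using le by (simp add: emeasure_distr space_PiM emeasure_PiM prod_ennreal)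
qed simp

text \<open>The preimage of a box is the box with its sides rearranged by \<open>inv p\<close>; the
  product of the side lengths is unchanged.\<close>

lemma lborel_distr_permute:
  fixes p :: "'n::finite \<Rightarrow> 'n"
  assumes "p permutes UNIV"
  shows "distr lborel borel (\<lambda>x. \<chi> i. x $ p i) = (lborel :: (real ^ 'n) measure)"
proof (rule lborel_vec_eqI[symmetric])
  have [measurable]: "(\<lambda>x::real ^ 'n. \<chi> i. x $ p i) \<in> borel_measurable borel"
    by (intro borel_measurable_continuous_onI continuous_intros)
  fix l u :: "real ^ 'n"
  assume le: "\<And>i. l $ i \<le> u $ i"
  let ?q = "inv p"
  have "(\<lambda>x. \<chi> i. x $ p i) -` box l u = box (\<chi> i. l $ ?q i) (\<chi> i. u $ ?q i)"
    using assms by (auto simp: mem_box_cart) (metis permutes_inverses)+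
  moreover have "emeasure lborel (box (\<chi> i. l $ ?q i) (\<chi> i. u $ ?q i))
      = ennreal (\<Prod>i\<in>UNIV. u $ ?q i - l $ ?q i)"
    by (subst emeasure_lborel_box_cart) (simp_all add: le)
  moreover have "(\<Prod>i\<in>UNIV. u $ ?q i - l $ ?q i) = (\<Prod>i\<in>UNIV. u $ i - l $ i)"
    using permutes_inv[OF assms] by (rule prod.permute[symmetric, unfolded o_def])
  ultimately show "emeasure (distr lborel borel (\<lambda>x. \<chi> i. x $ p i)) (box l u)
      = ennreal (\<Prod>i\<in>UNIV. u $ i - l $ i)"
    by (simp add: emeasure_distr)
qed simp

lemma
  fixes g :: "'n::finite \<Rightarrow> real \<Rightarrow> real"
  assumes "\<And>i. integrable lborel (g i)"
  shows integrable_lborel_prod: "integrable lborel (\<lambda>x::real ^ 'n. \<Prod>i\<in>UNIV. g i (x $ i))"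
    and integral_lborel_prod:
      "(LINT x|(lborel :: (real ^ 'n) measure). (\<Prod>i\<in>UNIV. g i (x $ i)))
        = (\<Prod>i\<in>UNIV. (LINT t|lborel. g i t))"
proof -
  interpret product_sigma_finite "\<lambda>i::'n. lborel :: real measure"
    by standard
  have [measurable]: "g i \<in> borel_measurable borel" for i
    using assms[of i] by auto
  have [measurable]: "(vec_lambda :: _ \<Rightarrow> real ^ 'n) \<in> borel_measurable (\<Pi>\<^sub>M i\<in>UNIV. lborel)"
    by (rule borel_measurable_vec_lambda) measurable
  have [measurable]: "(\<lambda>x::real ^ 'n. x $ i) \<in> borel_measurable borel" for i
    by (intro borel_measurable_continuous_onI continuous_intros)
  show "integrable lborel (\<lambda>x::real ^ 'n. \<Prod>i\<in>UNIV. g i (x $ i))"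
    unfolding lborel_vec_eq_distr_PiM
    by (subst integrable_distr_eq) (auto intro!: product_integrable_prod assms)
  show "(LINT x|(lborel :: (real ^ 'n) measure). (\<Prod>i\<in>UNIV. g i (x $ i)))
        = (\<Prod>i\<in>UNIV. (LINT t|lborel. g i t))"
    unfolding lborel_vec_eq_distr_PiM
    by (subst integral_distr) (auto intro!: product_integral_prod assms)
qed

text \<open>Points with a repeated coordinate lie in finitely many hyperplanes. On the remaining
  points the sorting permutation exists and is unique.\<close>

lemma AE_lborel_inj_vec_nth: "AE x in (lborel :: (real ^ 'n) measure). inj (($) x)"
proof -
  have "AE x in (lborel :: (real ^ 'n) measure). x $ i \<noteq> x $ j" if "i \<noteq> j" for i j
  proof -
    let ?H = "{x::real ^ 'n. (axis i 1 - axis j 1) \<bullet> x = 0}"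
    have H: "?H = {x. x $ i = x $ j}"
      by (auto simp: inner_diff_left inner_axis')
    have "axis i 1 \<noteq> (axis j 1 :: real ^ 'n)"
      using that by (simp add: axis_eq_axis)
    then have "negligible ?H"
      by (intro negligible_hyperplane) simp
    moreover have "?H \<in> sets lborel"
      using closed_hyperplane by simp
    \<comment> \<open>Negligibility refers to the completed measure; a Borel set that is null there
      is already null for \<open>lborel\<close>.\<close>
    ultimately have "?H \<in> null_sets lborel"
      by (simp only: negligible_iff_null_sets null_sets_completion_iff)
    then show ?thesis
      by (rule AE_I') (auto simp: H)
  qed
  then have "AE x in (lborel :: (real ^ 'n) measure). i \<noteq> j \<longrightarrow> x $ i \<noteq> x $ j" for i j
    by (cases "i = j") auto
  then have "AE x in (lborel :: (real ^ 'n) measure). \<forall>i j. i \<noteq> j \<longrightarrow> x $ i \<noteq> x $ j"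
    by (simp add: AE_all_countable)
  then show ?thesis
    by eventually_elim (auto simp: inj_def)
qed

subsection \<open>One-dimensional orthogonality\<close>

text \<open>For nonzero \<open>k\<close> the antiderivative is a multiple of
  \<open>sin (2 * pi * k * t)\<close>, which vanishes at 0 and, as \<open>k\<close> is an integer,
  at 1/2.\<close>

lemma has_bochner_integral_cos_half_period:
  fixes k :: int
  shows "has_bochner_integral lborel (\<lambda>t. cos (2 * pi * k * t) * indicator {0..1/2} t)
    (if k = 0 then 1/2 else 0)"
proof (cases "k = 0")
  case True
  have "has_bochner_integral lborel (\<lambda>t. 1 * indicator {0..1/2::real} t) (1/2 - 0 :: real)"
    by (rule has_bochner_integral_FTC_Icc_real) (auto intro!: derivative_eq_intros)
  with True show ?thesis by simp
next
  case False
  let ?F = "\<lambda>t. sin (2 * pi * k * t) / (2 * pi * k)"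
  have "has_bochner_integral lborel (\<lambda>t. cos (2 * pi * k * t) * indicator {0..1/2} t) (?F (1/2) - ?F 0)"
    by (rule has_bochner_integral_FTC_Icc_real)
      (use False in \<open>auto intro!: derivative_eq_intros continuous_intros\<close>)
  moreover have "sin (pi * k) = 0"
    by (simp add: sin_times_pi_eq_0 mult.commute)
  ultimately show ?thesis
    using False by simp
qed

text \<open>The product is half the difference of cosines with frequencies \<open>a - b\<close> and
  \<open>a + b\<close>. Positivity excludes \<open>a + b = 0\<close>, so only \<open>a = b\<close>
  contributes, with half of 1/2.\<close>

lemma has_bochner_integral_sin_sin_half_period:
  fixes a b :: int
  assumes "a > 0" "b > 0"
  shows "has_bochner_integral lborel
    (\<lambda>t. indicator {0..1/2} t * (sin (2 * pi * a * t) * sin (2 * pi * b * t)))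
    (if a = b then 1/4 else 0)"
proof -
  have "has_bochner_integral lborel
      (\<lambda>t. (cos (2 * pi * real_of_int (a - b) * t) * indicator {0..1/2} t
        - cos (2 * pi * real_of_int (a + b) * t) * indicator {0..1/2} t) / 2)
      (((if a - b = 0 then 1/2 else 0) - (if a + b = 0 then 1/2 else 0)) / 2)"
    by (intro has_bochner_integral_divide_zero has_bochner_integral_diff
        has_bochner_integral_cos_half_period)
  moreover have "(cos (2 * pi * real_of_int (a - b) * t) * indicator {0..1/2} t
        - cos (2 * pi * real_of_int (a + b) * t) * indicator {0..1/2} t) / 2
      = indicator {0..1/2} t * (sin (2 * pi * a * t) * sin (2 * pi * b * t))" for t :: real
    by (simp add: sin_times_sin algebra_simps diff_divide_distrib)
  moreover have "((if a - b = 0 then 1/2 else 0) - (if a + b = 0 then 1/2 else 0)) / 2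
      = (if a = b then 1/4 else 0 :: real)"
    using assms by auto
  ultimately show ?thesis
    by (simp only:)
qed

subsection \<open>The determinants\<close>

lemma sin_minus_eq_sum:
  "sin_minus m x = (\<Sum>p | p permutes UNIV. of_int (sign p) * (\<Prod>i\<in>UNIV. sin (2 * pi * real_of_int (m $ p i) * x $ i)))"
proof -
  \<comment> \<open>Transposing moves the permutation from the coordinates of \<open>x\<close> to
    the entries of \<open>m\<close>, so factor \<open>i\<close> depends on \<open>x $ i\<close>
    alone, as Fubini requires.\<close>
  have "sin_minus m x = det (transpose (\<chi> i j. sin (2 * pi * real_of_int (m $ i) * x $ j)))"
    by (simp add: sin_minus_def)
  then show ?thesis
    by (simp only: det_def transpose_def vec_lambda_beta)
qed

lemma sin_minus_permute:
  fixes m :: "int ^ 'n::finite"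
  assumes "p permutes UNIV"
  shows "sin_minus m (\<chi> i. x $ p i) = of_int (sign p) * sin_minus m x"
  unfolding sin_minus_def
  using det_permute_columns[OF assms, of "\<chi> i j. sin (2 * pi * real_of_int (m $ i) * x $ j)"]
  by (simp only: vec_lambda_beta)

text \<open>The pair \<open>p\<close>, \<open>q\<close> contributes only if \<open>m\<close> along
  \<open>p\<close> agrees with \<open>m'\<close> along \<open>q\<close>. As both tuples decrease
  strictly, this forces \<open>p = q\<close> and \<open>m = m'\<close>, leaving
  \<open>fact CARD('n)\<close> diagonal terms.\<close>

lemma has_bochner_integral_cube_sin_minus:
  fixes m m' :: "int ^ 'n::{finite,linorder}"
  assumes m: "strictly_decreasing_positive m" and m': "strictly_decreasing_positive m'"
  shows "has_bochner_integral lborel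
    (\<lambda>x. (\<Prod>i\<in>UNIV. indicator {0..1/2} (x $ i)) * (sin_minus m x * sin_minus m' x))
    (if m = m' then fact CARD('n) / 4 ^ CARD('n) else 0)"
proof -
  let ?P = "{p::'n \<Rightarrow> 'n. p permutes UNIV}"
  let ?g = "\<lambda>p q i t. indicator {0..1/2} t
    * (sin (2 * pi * real_of_int (m $ p i) * t) * sin (2 * pi * real_of_int (m' $ q i) * t))"
  let ?c = "\<lambda>p q i. if m $ p i = m' $ q i then 1/4 else 0 :: real"
  have pos: "m $ i > 0" "m' $ i > 0" for i
    using m m' by (auto simp: strictly_decreasing_positive_def)
  have g: "has_bochner_integral lborel (?g p q i) (?c p q i)" for p q :: "'n \<Rightarrow> 'n" and i
    by (rule has_bochner_integral_sin_sin_half_period) (rule pos)+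
  have "has_bochner_integral lborel (\<lambda>x::(real, 'n) vec. \<Prod>i\<in>UNIV. ?g p q i (x $ i)) (\<Prod>i\<in>UNIV. ?c p q i)"
    for p q :: "'n \<Rightarrow> 'n"
    using g integrable_lborel_prod[of "?g p q"] integral_lborel_prod[of "?g p q"]
    by (simp add: has_bochner_integral_iff)
  then have "has_bochner_integral lborel
      (\<lambda>x::(real, 'n) vec. \<Sum>p\<in>?P. \<Sum>q\<in>?P. (of_int (sign p) * of_int (sign q)) * (\<Prod>i\<in>UNIV. ?g p q i (x $ i)))
      (\<Sum>p\<in>?P. \<Sum>q\<in>?P. (of_int (sign p) * of_int (sign q)) * (\<Prod>i\<in>UNIV. ?c p q i))"
    by (intro has_bochner_integral_sum has_bochner_integral_mult_right)
  moreover have "(\<Sum>p\<in>?P. \<Sum>q\<in>?P. (of_int (sign p) * of_int (sign q)) * (\<Prod>i\<in>UNIV. ?g p q i (x $ i)))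
      = (\<Prod>i\<in>UNIV. indicator {0..1/2} (x $ i)) * (sin_minus m x * sin_minus m' x)" for x :: "(real, 'n) vec"
    unfolding sin_minus_eq_sum sum_product
    unfolding sum_distrib_left
    by (intro sum.cong refl) (simp add: prod.distrib mult_ac)
  moreover have "(\<Sum>p\<in>?P. \<Sum>q\<in>?P. (of_int (sign p) * of_int (sign q)) * (\<Prod>i\<in>UNIV. ?c p q i))
      = (if m = m' then fact CARD('n) / 4 ^ CARD('n) else 0)"
  proof -
    have "(of_int (sign p) * of_int (sign q)) * (\<Prod>i\<in>UNIV. ?c p q i)
        = (if p = q then if m = m' then 1 / 4 ^ CARD('n) else 0 else 0)"
      if p: "p \<in> ?P" and q: "q \<in> ?P" for p q
    proof (cases "\<forall>i. m $ p i = m' $ q i")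
      case True
      have q': "inv q permutes UNIV"
        using q by (simp add: permutes_inv)
      have eq: "m $ (p \<circ> inv q) i = m' $ i" for i
        using True q by (metis comp_apply mem_Collect_eq permutes_inverses(1))
      have inj: "inj (($) m)"
        using m unfolding strictly_decreasing_positive_def
        by (metis injI less_irrefl linorder_neqE)
      have "bij (p \<circ> inv q)"
        using p q' by (simp add: permutes_bij bij_comp)
      \<comment> \<open>By \<open>eq\<close>, reading \<open>m\<close> along
        \<open>p \<circ> inv q\<close> gives the decreasing tuple \<open>m'\<close>, while
        \<open>id\<close> already sorts \<open>m\<close>; sorting permutations are unique.\<close>
      then have "p \<circ> inv q = id"
        by (rule sorting_permutation_unique[OF inj _ bij_id])
          (use m m' in \<open>simp_all only: eq id_apply strictly_decreasing_positive_def\<close>)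
      then have "p = q"
        using q by (metis comp_assoc comp_id id_comp mem_Collect_eq permutes_inv_o(2))
      moreover have "m = m'"
        using eq \<open>p \<circ> inv q = id\<close> by (simp add: vec_eq_iff)
      moreover have "of_int (sign q) * of_int (sign q) = (1::real)"
        by (metis of_int_1 of_int_mult sign_idempotent)
      ultimately show ?thesis
        by (simp add: power_one_over)
    next
      case False
      then obtain i where "m $ p i \<noteq> m' $ q i" by blast
      moreover from this have "(\<Prod>i\<in>UNIV. ?c p q i) = 0"
        by (intro prod_zero) auto
      ultimately show ?thesis by auto
    qed
    then have "(\<Sum>p\<in>?P. \<Sum>q\<in>?P. (of_int (sign p) * of_int (sign q)) * (\<Prod>i\<in>UNIV. ?c p q i))
        = (\<Sum>p\<in>?P. if m = m' then 1 / 4 ^ CARD('n) else 0)"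
      by (simp add: finite_permutations)
    also have "\<dots> = (if m = m' then fact CARD('n) / 4 ^ CARD('n) else 0)"
      by (simp add: card_permutations)
    finally show ?thesis .
  qed
  ultimately show ?thesis by simp
qed

subsection \<open>Tiling the cube by simplices\<close>

lemma closed_closed_F: "closed (closed_F :: (real ^ 'n::{finite,linorder}) set)"
proof -
  have eq: "(closed_F :: (real, 'n) vec set) = (\<Inter>i. {x::(real, 'n) vec. 0 \<le> x $ i} \<inter> {x. x $ i \<le> 1/2})
      \<inter> (\<Inter>i. \<Inter>j\<in>{i..}. {x. x $ j \<le> x $ i})"
    by (auto simp: closed_F_def)
  show ?thesis
    unfolding eq by (intro closed_Int closed_INT ballI closed_Collect_le continuous_intros)
qed

text \<open>Exactly one rearrangement of distinct coordinates is decreasing, so a point of the cube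
  is counted once. Ties would be counted several times, hence the injectivity hypothesis.\<close>

lemma sum_indicator_closed_F:
  fixes x :: "real ^ 'n::{finite,linorder}"
  assumes inj: "inj (($) x)"
  shows "(\<Sum>p | p permutes UNIV. indicator closed_F (\<chi> i. x $ p i))
    = (\<Prod>i\<in>UNIV. indicator {0..1/2} (x $ i) :: real)"
proof (cases "\<forall>i. x $ i \<in> {0..1/2}")
  case True
  obtain p where p: "p permutes UNIV" "\<And>i j. i < j \<Longrightarrow> x $ p j < x $ p i"
    using sorting_permutation_exists[OF inj] by blast
  have "(\<chi> i. x $ q i) \<in> closed_F \<longleftrightarrow> q = p" if q: "q permutes UNIV" for q
  proof
    assume "(\<chi> i. x $ q i) \<in> closed_F"
    then have "x $ q j \<le> x $ q i" if "i \<le> j" for i j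
      using that by (simp add: closed_F_def)
    moreover have "x $ q j \<noteq> x $ q i" if "i < j" for i j
      using that inj permutes_inj[OF q] by (metis injD less_irrefl)
    ultimately have "x $ q j < x $ q i" if "i < j" for i j
      using that by (simp add: order_less_le)
    then show "q = p"
      using sorting_permutation_unique[OF inj permutes_bij[OF q] permutes_bij[OF p(1)]] p(2) by blast
  next
    assume "q = p"
    then show "(\<chi> i. x $ q i) \<in> closed_F"
      using True p(2) by (auto simp: closed_F_def order_le_less)
  qed
  then have "(\<Sum>q | q permutes UNIV. indicator closed_F (\<chi> i. x $ q i))
      = (\<Sum>q | q permutes UNIV. if q = p then 1 else 0 :: real)"
    by (intro sum.cong) (auto simp: indicator_def)
  also have "\<dots> = 1"
    using p(1) by (simp add: finite_permutations)
  finally show ?thesis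
    using True by simp
next
  case False
  then obtain k where k: "x $ k \<notin> {0..1/2}" by blast
  have "(\<chi> i. x $ q i) \<notin> closed_F" if "q permutes UNIV" for q
  proof
    assume "(\<chi> i. x $ q i) \<in> closed_F"
    \<comment> \<open>\<open>inv q k\<close> is the position to which the offending coordinate
      \<open>x $ k\<close> has been moved.\<close>
    then have "x $ q (inv q k) \<in> {0..1/2}"
      by (simp add: closed_F_def)
    with k that show False
      by (simp add: permutes_inverses)
  qed
  moreover have "(\<Prod>i\<in>UNIV. indicator {0..1/2} (x $ i) :: real) = 0"
    using k by (intro prod_zero bexI[of _ k]) auto
  ultimately show ?thesis by simp
qed

text \<open>Almost everywhere the indicator of the cube is the sum of the indicators of the permuted
  simplices. By symmetry of \<open>f\<close> and permutation invariance of \<open>lborel\<close>,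
  all \<open>fact CARD('n)\<close> pieces have the same integral.\<close>

lemma integral_cube_eq_fact_mult_integral_closed_F:
  fixes f :: "real ^ 'n::{finite,linorder} \<Rightarrow> real"
  assumes int: "integrable lborel (\<lambda>x. (\<Prod>i\<in>UNIV. indicator {0..1/2} (x $ i)) * f x)"
    and symm: "\<And>p x. p permutes UNIV \<Longrightarrow> f (\<chi> i. x $ p i) = f x"
  shows "(LINT x|lborel. (\<Prod>i\<in>UNIV. indicator {0..1/2} (x $ i)) * f x)
    = fact CARD('n) * (LINT x:closed_F|lborel. f x)"
proof -
  let ?h = "\<lambda>x. indicator closed_F x * f x"
  let ?T = "\<lambda>p x. \<chi> i. x $ p i :: (real, 'n) vec"
  have [measurable]: "?T p \<in> borel_measurable borel" for p :: "'n \<Rightarrow> 'n"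
    by (intro borel_measurable_continuous_onI continuous_intros)
  \<comment> \<open>The simplex lies inside the cube, so integrability over it is inherited by
    restriction.\<close>
  have "integrable lborel (\<lambda>x. indicator closed_F x *\<^sub>R ((\<Prod>i\<in>UNIV. indicator {0..1/2} (x $ i)) * f x))"
    by (rule integrable_mult_indicator) (use int borel_closed[OF closed_closed_F] in simp_all)
  moreover have "indicator closed_F x *\<^sub>R ((\<Prod>i\<in>UNIV. indicator {0..1/2} (x $ i)) * f x) = ?h x" for x
    by (auto simp: indicator_def closed_F_def)
  ultimately have h: "integrable lborel ?h" by (simp only:)
  then have [measurable]: "?h \<in> borel_measurable borel" by auto
  have hT: "integrable lborel (\<lambda>x. ?h (?T p x))" "(LINT x|lborel. ?h (?T p x)) = (LINT x|lborel. ?h x)"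
    if "p permutes UNIV" for p
  proof -
    note d = lborel_distr_permute[OF that]
    show "integrable lborel (\<lambda>x. ?h (?T p x))"
      using h integrable_distr_eq[of "?T p" lborel borel ?h] by (simp add: d)
    show "(LINT x|lborel. ?h (?T p x)) = (LINT x|lborel. ?h x)"
      using integral_distr[of "?T p" lborel borel ?h] by (simp add: d)
  qed
  have "(LINT x|lborel. (\<Prod>i\<in>UNIV. indicator {0..1/2} (x $ i)) * f x)
      = (LINT x|lborel. (\<Sum>p | p permutes UNIV. ?h (?T p x)))"
  proof (rule integral_cong_AE)
    show "(\<lambda>x. (\<Prod>i\<in>UNIV. indicator {0..1/2} (x $ i)) * f x) \<in> borel_measurable lborel"
      using int by auto
    show "(\<lambda>x. \<Sum>p | p permutes UNIV. ?h (?T p x)) \<in> borel_measurable lborel"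
      using hT(1) by (intro borel_measurable_sum) auto
    show "AE x in lborel. (\<Prod>i\<in>UNIV. indicator {0..1/2} (x $ i)) * f x
        = (\<Sum>p | p permutes UNIV. ?h (?T p x))"
      using AE_lborel_inj_vec_nth
    proof eventually_elim
      case (elim x)
      show ?case
        by (simp add: symm sum_indicator_closed_F[OF elim, symmetric] sum_distrib_right)
    qed
  qed
  also have "\<dots> = (\<Sum>p | p permutes UNIV. (LINT x|lborel. ?h (?T p x)))"
    by (rule Bochner_Integration.integral_sum, rule hT(1)) simp
  also have "\<dots> = (\<Sum>p | p permutes (UNIV::'n set). (LINT x|lborel. ?h x))"
    by (rule sum.cong[OF refl], rule hT(2)) simp
  also have "\<dots> = fact CARD('n) * (LINT x:closed_F|lborel. f x)"
    by (simp add: card_permutations set_lebesgue_integral_def)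
  finally show ?thesis .
qed

theorem mainTheorem1:
  fixes m m' :: "int ^ 'n::{finite,linorder}"
  assumes "strictly_decreasing_positive m"
    and "strictly_decreasing_positive m'"
  shows "2 ^ (2 * CARD('n)) * (LINT x:closed_F|lborel. sin_minus m x * sin_minus m' x)
           = (if m = m' then 1 else (0::real))"
proof -
  let ?f = "\<lambda>x. sin_minus m x * sin_minus m' x"
  \<comment> \<open>Each determinant picks up the factor \<open>sign p\<close>; in the product the
    two signs cancel.\<close>
  have symm: "?f (\<chi> i. x $ p i) = ?f x" if "p permutes UNIV" for p x
  proof -
    have "of_int (sign p) * of_int (sign p) = (1::real)"
      by (metis of_int_1 of_int_mult sign_idempotent)
    then show ?thesis
      by (simp add: sin_minus_permute[OF that])
  qed
  note cube = has_bochner_integral_cube_sin_minus[OF assms, unfolded has_bochner_integral_iff]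
  have "fact CARD('n) * (LINT x:closed_F|lborel. ?f x)
      = (if m = m' then fact CARD('n) / 4 ^ CARD('n) else 0)"
    using integral_cube_eq_fact_mult_integral_closed_F[of ?f] cube symm by simp
  then have "(LINT x:closed_F|lborel. ?f x) = (if m = m' then 1 / 4 ^ CARD('n) else 0)"
    by (auto simp: field_simps split: if_splits)
  then show ?thesis
    by (simp add: power_mult)
qed

end
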